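(* If $q$ is a prime and $v$ is a positive integer, then there are infinitely many primes which are congruent to $1$ modulo $q^v$. *)

theory Defs
  imports "HOL-Number_Theory.Number_Theory"
begin

end

theory Submission
  imports Defs
begin

text \<open>
  Euclid's argument with the cyclotomic polynomial of order \<open>q ^ v\<close> evaluated at \<open>a = q * fact n\<close>:
  with \<open>y = a ^ q ^ (v - 1)\<close>, a prime divisor \<open>p\<close> of \<open>1 + y + \<dots> + y ^ (q - 1)\<close> does not divide \<open>a\<close>,
  so \<open>p > n\<close> and \<open>p \<noteq> q\<close>. Moreover \<open>y ^ q\<close> is \<open>1\<close> modulo \<open>p\<close> but \<open>y\<close> is not (otherwise
  \<open>p\<close> would divide \<open>q\<close>), so \<open>a\<close> has order \<open>q ^ v\<close> modulo \<open>p\<close>, and this order divides \<open>p - 1\<close>.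
\<close>

text \<open>The sum times \<open>y - 1\<close> telescopes to \<open>y ^ n - 1\<close>; the argument
  runs over the integers because subtraction on \<open>nat\<close> truncates.\<close>

lemma cong_power_one_if_dvd_geometric_sum:
  fixes p y n :: nat
  assumes "p dvd (\<Sum>i<n. y ^ i)"
  shows "[y ^ n = 1] (mod p)"
proof -
  have "int p dvd (\<Sum>i<n. int y ^ i)"
    using assms by (metis of_nat_dvd_iff of_nat_power of_nat_sum sum.cong)
  then have "int p dvd int y ^ n - 1"
    by (simp add: power_diff_1_eq)
  then have "[int (y ^ n) = int 1] (mod int p)"
    by (simp add: cong_iff_dvd_diff)
  then show ?thesis
    by (simp only: cong_int_iff)
qed

lemma coprime_if_dvd_geometric_sum:
  fixes p y n :: nat
  assumes "p dvd (\<Sum>i<n. y ^ i)" and "n > 0"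
  shows "coprime p y"
proof -
  have "[y ^ n = 1] (mod p)"
    using assms(1) by (rule cong_power_one_if_dvd_geometric_sum)
  then have "coprime p (y ^ n)"
    by (metis cong_imp_coprime cong_sym coprime_1_left coprime_commute)
  with \<open>n > 0\<close> show ?thesis
    by simp
qed

text \<open>Divisors of \<open>q ^ Suc w\<close> are powers of \<open>q\<close>, and an order
  \<open>q ^ i\<close> with \<open>i \<le> w\<close> would divide \<open>q ^ w\<close>, forcing
  \<open>a ^ q ^ w\<close> to be 1 modulo \<open>p\<close>.\<close>

lemma ord_eq_prime_power:
  fixes q a p :: nat
  assumes "prime q" and "[a ^ q ^ Suc w = 1] (mod p)" and "\<not> [a ^ q ^ w = 1] (mod p)"
  shows "ord p a = q ^ Suc w"
proof -
  have "ord p a dvd q ^ Suc w"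
    using assms(2) by (simp only: ord_divides)
  then obtain i where i: "i \<le> Suc w" "ord p a = q ^ i"
    using divides_primepow_nat[OF \<open>prime q\<close>] by blast
  moreover have "\<not> i \<le> w"
    using assms(3) i(2) by (metis ord_divides le_imp_power_dvd)
  ultimately show ?thesis
    by (simp add: le_Suc_eq)
qed

lemma exists_prime_cong_one_mod_prime_power:
  fixes q :: nat
  assumes "prime q"
  obtains p :: nat where "prime p" "p > n" "[p = 1] (mod q ^ Suc w)"
proof -
  define a where "a = q * fact n"
  define y where "y = a ^ q ^ w"
  define m where "m = (\<Sum>i<q. y ^ i)"
  have "q \<ge> 2"
    using assms by (rule prime_ge_2_nat)
  then have "a > 0" "y > 0"
    by (simp_all add: a_def y_def)
  have "m > 1"
  proof -
    have "(\<Sum>i<q. 1) \<le> m"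
      unfolding m_def using \<open>y > 0\<close> by (intro sum_mono) (simp add: Suc_leI)
    with \<open>q \<ge> 2\<close> show ?thesis by simp
  qed
  then obtain p where p: "prime p" "p dvd m"
    using prime_factor_nat[of m] by auto
  have "coprime p y"
    using p(2) \<open>q \<ge> 2\<close> unfolding m_def by (intro coprime_if_dvd_geometric_sum) auto
  then have cop: "coprime p a"
    using \<open>q \<ge> 2\<close> by (simp add: y_def)
  then have "\<not> p dvd a"
    using p(1) by (metis coprime_absorb_left not_prime_unit)
  \<comment> \<open>Every prime up to \<open>n\<close> divides \<open>fact n\<close> and hence
    \<open>a\<close>; the factor \<open>q\<close> of \<open>a\<close> rules out
    \<open>p dvd q\<close>.\<close>
  then have "p > n" "\<not> p dvd q"
    using p(1) by (auto simp: a_def prime_dvd_mult_iff prime_dvd_fact_iff not_le)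
  have "[a ^ q ^ Suc w = 1] (mod p)"
    using cong_power_one_if_dvd_geometric_sum[of p y q] p(2)
    by (simp add: m_def y_def flip: power_mult) (simp add: mult.commute)
  moreover have "\<not> [y = 1] (mod p)"
  proof
    assume "[y = 1] (mod p)"
    \<comment> \<open>Each of the \<open>q\<close> summands of \<open>m\<close> becomes 1, so
      \<open>m\<close> is congruent to \<open>q\<close> modulo \<open>p\<close>.\<close>
    then have "[m = (\<Sum>i<q. 1 ^ i)] (mod p)"
      unfolding m_def by (intro cong_sum cong_pow)
    then have "p dvd q"
      using p(2) by (simp add: cong_dvd_iff)
    with \<open>\<not> p dvd q\<close> show False ..
  qed
  ultimately have "ord p a = q ^ Suc w"
    using assms by (intro ord_eq_prime_power) (simp_all add: y_def)
  then have "q ^ Suc w dvd p - 1"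
    using order_divides_totient[OF cop] p(1) by (simp add: totient_prime)
  then have "[p = 1] (mod q ^ Suc w)"
    using prime_ge_1_nat[OF p(1)] by (simp add: cong_altdef_nat)
  with p(1) \<open>p > n\<close> show thesis
    by (rule that)
qed

theorem corollary10:
  fixes q v :: nat
  assumes "prime q" and "v > 0"
  shows "infinite {p :: nat. prime p \<and> [p = 1] (mod q ^ v)}"
proof -
  obtain w where "v = Suc w"
    using \<open>v > 0\<close> gr0_implies_Suc by blast
  then show ?thesis
    unfolding infinite_nat_iff_unbounded
    using exists_prime_cong_one_mod_prime_power[OF \<open>prime q\<close>] by (metis mem_Collect_eq)
qed

end
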